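(* If a graph $G$ has a perfect matching, then $p(G)=1$, where $p(G)$ denotes the $P$-vertex covering number of $G$.
   Context: Graphs are finite, simple and undirected; a graph on $n\ge 1$ vertices has vertex set $[n]=\{1,\ldots,n\}$. For a real symmetric $n\times n$ matrix $A=(a_{ij})$, its support graph $G(A)$ is the graph with vertex set $[n]$ and edge set $\{\{i,j\}: i\neq j,\ a_{ij}\neq 0\}$ (diagonal entries play no role). For a graph $G$ on $n$ vertices, $S(G)=\{A\in\mathbb{R}^{n\times n}: A^{T}=A,\ G(A)=G\}$. For $i\in[n]$, $A(i)$ denotes the principal submatrix of $A$ obtained by deleting the $i$-th row and the $i$-th column. $m_A(\lambda)$ denotes the algebraic multiplicity of $\lambda$ as an eigenvalue of $A$ (equal to $0$ if $\lambda$ is not an eigenvalue). A vertex $i$ of $G$ is called a $P$-vertex of $A\in S(G)$ if $m_{A(i)}(0)-m_A(0)=1$. The $P$-vertex covering number $p(G)$ is the minimum cardinality $|\mathcal{A}|$ of a family $\mathcal{A}\subseteq S(G)$ of non-singular matrices such that every vertex of $G$ is a $P$-vertex of some $A\in\mathcal{A}$; if no such family exists, $p(G)=\infty$. (Thus $p(G)=1$ means that there is a single non-singular matrix in $S(G)$ for which every vertex of $G$ is a $P$-vertex.) *)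

theory Defs
  imports "Jordan_Normal_Form.Char_Poly" "HOL-Library.Extended_Nat"
begin

text \<open>
  A graph on \<open>n\<close> vertices is given by \<open>n\<close> and its edge set \<open>E\<close>. Its vertices are
  \<open>{0..<n}\<close> rather than \<open>{1..n}\<close>, so that they coincide with the row and column
  indices of an \<open>n \<times> n\<close> matrix.
\<close>

definition simple_graph :: "nat \<Rightarrow> nat set set \<Rightarrow> bool" where
  "simple_graph n E \<longleftrightarrow> (\<forall>e\<in>E. e \<subseteq> {0..<n} \<and> card e = 2)"

definition perfect_matching :: "nat \<Rightarrow> nat set set \<Rightarrow> nat set set \<Rightarrow> bool" where
  "perfect_matching n E M \<longleftrightarrow> M \<subseteq> E \<and> (\<forall>v\<in>{0..<n}. \<exists>!e. e \<in> M \<and> v \<in> e)"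

definition has_perfect_matching :: "nat \<Rightarrow> nat set set \<Rightarrow> bool" where
  "has_perfect_matching n E \<longleftrightarrow> (\<exists>M. perfect_matching n E M)"

definition support_edges :: "real mat \<Rightarrow> nat set set" where
  "support_edges A =
     {{i, j} | i j. i < dim_row A \<and> j < dim_col A \<and> i \<noteq> j \<and> A $$ (i, j) \<noteq> 0}"

definition sym_mats :: "nat \<Rightarrow> nat set set \<Rightarrow> real mat set" where
  "sym_mats n E = {A \<in> carrier_mat n n. transpose_mat A = A \<and> support_edges A = E}"

definition alg_mult :: "real mat \<Rightarrow> real \<Rightarrow> nat" where
  "alg_mult A x = Polynomial.order x (char_poly A)"

definition P_vertex :: "real mat \<Rightarrow> nat \<Rightarrow> bool" where
  "P_vertex A i \<longleftrightarrow> int (alg_mult (mat_delete A i i) 0) - int (alg_mult A 0) = 1"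

definition P_cover :: "nat \<Rightarrow> nat set set \<Rightarrow> real mat set \<Rightarrow> bool" where
  "P_cover n E \<A> \<longleftrightarrow>
     \<A> \<subseteq> sym_mats n E \<and> (\<forall>A\<in>\<A>. invertible_mat A) \<and> (\<forall>i\<in>{0..<n}. \<exists>A\<in>\<A>. P_vertex A i)"

text \<open>
  Infinite covering families can be left out: each contains a finite one, because there
  are finitely many vertices. If there is no covering family, the infimum is
  \<open>Inf {} = \<infinity>\<close>; otherwise it is attained, since \<open>enat\<close> is well-ordered.
\<close>

definition P_covering_number :: "nat \<Rightarrow> nat set set \<Rightarrow> enat" where
  "P_covering_number n E = Inf {enat (card \<A>) | \<A>. finite \<A> \<and> P_cover n E \<A>}"

end

theory Submission
  imports Defs
begin

text \<open>
  A vertex \<open>i\<close> is a P-vertex of a non-singular symmetric \<open>A\<close> as soon as the \<open>i\<close>-th diagonal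
  entry of \<open>A\<^sup>-\<^sup>1\<close> vanishes. A perfect matching is an involution \<open>\<sigma>\<close>, whose permutation matrix \<open>P\<close>
  equals its own inverse and has zero diagonal. Put the remaining edges in as a small perturbation
  \<open>e B\<close>; a diagonal matrix \<open>D\<close> then restores the zero diagonal of the inverse of
  \<open>A = P + e B + D\<close>. The inverse \<open>X\<close> is sought instead of \<open>D\<close>: the \<open>(i, \<sigma> i)\<close> entry of
  \<open>A X = I\<close>, with \<open>X (\<sigma> i, \<sigma> i) = 0\<close>, forces \<open>d i = - e (B X) (i, \<sigma> i) / X (i, \<sigma> i)\<close>, and
  substituting this into \<open>X = P - P (e B + D) X\<close> gives a fixed point equation whose right-hand
  side is a contraction near \<open>P\<close> and has zero diagonal whatever \<open>X\<close> is.
\<close>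

section \<open>Fixed points of contractions in the sup norm\<close>

text \<open>Banach's theorem on the closed ball of radius \<open>r\<close> about \<open>A\<close>,
  with factor 1/2. The first step has length at most \<open>r / 2\<close>, so the geometric series
  of all steps stays within \<open>r\<close>.\<close>

lemma sup_contraction_fixpoint:
  fixes F :: "('a \<Rightarrow> real) \<Rightarrow> 'a \<Rightarrow> real"
  assumes near: "\<And>a. \<bar>F A a - A a\<bar> \<le> r / 2"
    and contr: "\<And>X Y c a. (\<And>b. \<bar>X b - A b\<bar> \<le> r) \<Longrightarrow> (\<And>b. \<bar>Y b - A b\<bar> \<le> r) \<Longrightarrow>
        (\<And>b. \<bar>X b - Y b\<bar> \<le> c) \<Longrightarrow> \<bar>F X a - F Y a\<bar> \<le> c / 2"
  shows "\<exists>X. (\<forall>a. \<bar>X a - A a\<bar> \<le> r) \<and> F X = X"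
proof -
  have r: "0 \<le> r"
    using near[of undefined] by linarith
  have nonneg: "0 \<le> r * (1/2) ^ k" for k :: nat
    using r by simp
  define Z where "Z k = (F ^^ k) A" for k
  have Z0: "Z 0 = A" and ZS: "Z (Suc k) = F (Z k)" for k
    by (simp_all add: Z_def)
  \<comment> \<open>Both bounds go through one induction: \<open>contr\<close> applies to
    consecutive iterates only once both lie in the ball, and the radius
    \<open>r * (1 - (1/2) ^ k)\<close> leaves room for exactly the next step.\<close>
  have Z: "(\<forall>a. \<bar>Z k a - A a\<bar> \<le> r * (1 - (1/2) ^ k)) \<and>
           (\<forall>a. \<bar>Z (Suc k) a - Z k a\<bar> \<le> r * (1/2) ^ Suc k)" for k
  proof (induction k)
    case 0
    then show ?case using near by (simp add: Z0 ZS)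
  next
    case (Suc k)
    have a: "\<bar>Z (Suc k) a - A a\<bar> \<le> r * (1 - (1/2) ^ Suc k)" for a
    proof -
      have "\<bar>Z (Suc k) a - A a\<bar> \<le> r * (1/2) ^ Suc k + r * (1 - (1/2) ^ k)"
        using conjunct1[OF Suc.IH, rule_format, of a] conjunct2[OF Suc.IH, rule_format, of a]
        by linarith
      then show ?thesis by (simp add: algebra_simps)
    qed
    have ball: "\<bar>Z j b - A b\<bar> \<le> r" if "j = k \<or> j = Suc k" for j b
    proof -
      have "\<bar>Z j b - A b\<bar> \<le> r * (1 - (1/2) ^ j)"
        using a Suc.IH that by blast
      also have "\<dots> \<le> r * 1"
        using r by (intro mult_left_mono) simp_all
      finally show ?thesis by simp
    qed
    have "\<bar>F (Z (Suc k)) b - F (Z k) b\<bar> \<le> r * (1/2) ^ Suc k / 2" for b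
      using Suc.IH by (intro contr ball) simp_all
    with a show ?case by (simp add: ZS)
  qed
  have Zdiff: "\<bar>Z (k + m) a - Z k a\<bar> \<le> r * (1/2) ^ k - r * (1/2) ^ (k + m)" for k m a
  proof (induction m)
    case (Suc m)
    have "\<bar>Z (k + Suc m) a - Z k a\<bar> \<le> \<bar>Z (Suc (k + m)) a - Z (k + m) a\<bar> + \<bar>Z (k + m) a - Z k a\<bar>"
      by simp
    also have "\<dots> \<le> r * (1/2) ^ Suc (k + m) + (r * (1/2) ^ k - r * (1/2) ^ (k + m))"
      using Z Suc by (intro add_mono) blast+
    finally show ?case by (simp add: algebra_simps)
  qed simp
  have conv: "\<exists>l. (\<lambda>k. Z k a) \<longlonglongrightarrow> l" for a
  proof -
    have "summable (\<lambda>k. Z (Suc k) a - Z k a)"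
    proof (rule summable_comparison_test')
      show "summable (\<lambda>k. r * (1/2) ^ Suc k)"
        by (intro summable_mult) simp
      show "norm (Z (Suc k) a - Z k a) \<le> r * (1/2) ^ Suc k" for k
        using Z by simp
    qed
    then have "(\<lambda>k. \<Sum>j<k. Z (Suc j) a - Z j a) \<longlonglongrightarrow> (\<Sum>j. Z (Suc j) a - Z j a)"
      by (rule summable_LIMSEQ)
    moreover have "(\<Sum>j<k. Z (Suc j) a - Z j a) = Z k a - Z 0 a" for k
      by (induction k) simp_all
    ultimately have "(\<lambda>k. Z k a - Z 0 a) \<longlonglongrightarrow> (\<Sum>j. Z (Suc j) a - Z j a)"
      by simp
    from tendsto_add[OF this tendsto_const[of "Z 0 a"]] show ?thesis by auto
  qed
  define X where "X a = lim (\<lambda>k. Z k a)" for a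
  have X: "(\<lambda>k. Z k a) \<longlonglongrightarrow> X a" for a
    using conv[of a] unfolding X_def convergent_LIMSEQ_iff[symmetric] convergent_def .
  \<comment> \<open>The limit is taken pointwise, but this error bound does not depend on
    \<open>a\<close>, as \<open>contr\<close> requires for comparing \<open>F X\<close> with
    \<open>F (Z k)\<close>.\<close>
  have XZ: "\<bar>X a - Z k a\<bar> \<le> r * (1/2) ^ k" for a k
  proof (rule LIMSEQ_le_const2)
    show "(\<lambda>m. \<bar>Z (k + m) a - Z k a\<bar>) \<longlonglongrightarrow> \<bar>X a - Z k a\<bar>"
      using LIMSEQ_ignore_initial_segment[OF X, of k a]
      by (intro tendsto_rabs tendsto_diff tendsto_const) (simp add: add.commute)
    show "\<exists>N. \<forall>m\<ge>N. \<bar>Z (k + m) a - Z k a\<bar> \<le> r * (1/2) ^ k"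
    proof (intro exI allI impI)
      fix m
      show "\<bar>Z (k + m) a - Z k a\<bar> \<le> r * (1/2) ^ k"
        using Zdiff[of k m a] nonneg[of "k + m"] by linarith
    qed
  qed
  have ballX: "\<bar>X a - A a\<bar> \<le> r" for a
    using XZ[of a 0] by (simp add: Z0)
  have ballZ: "\<bar>Z k a - A a\<bar> \<le> r" for k a
    using Zdiff[of 0 k a] nonneg[of k] by (simp add: Z0)
  have "F X a = X a" for a
  proof (rule LIMSEQ_unique)
    have "(\<lambda>k. Z (Suc k) a - F X a) \<longlonglongrightarrow> 0"
    proof (rule tendsto_0_le)
      show "(\<lambda>k. (1/2) ^ k :: real) \<longlonglongrightarrow> 0"
        by (rule LIMSEQ_power_zero) simp
      have "\<bar>Z (Suc k) a - F X a\<bar> \<le> r * (1/2) ^ k / 2" for k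
        unfolding ZS using XZ by (intro contr ballX ballZ) (simp add: abs_minus_commute)
      then show "\<forall>\<^sub>F k in sequentially. norm (Z (Suc k) a - F X a) \<le> norm ((1/2) ^ k :: real) * (r / 2)"
        by (simp add: mult.commute)
    qed
    then show "(\<lambda>k. Z (Suc k) a) \<longlonglongrightarrow> F X a"
      by (simp add: LIM_zero_iff)
    show "(\<lambda>k. Z (Suc k) a) \<longlonglongrightarrow> X a"
      using X by (rule LIMSEQ_Suc)
  qed
  with ballX show ?thesis by blast
qed

section \<open>Perturbing an involution while keeping the inverse's diagonal zero\<close>

text \<open>Only the sum is cut off at \<open>n\<close>; all else is indexed by all naturals, so the
  sup norm estimates need no range conditions. Fixed points of \<sigma> are merely exempt from the
  diagonal claim.\<close>

lemma perturbed_involution_inverse: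
  fixes B :: "nat \<Rightarrow> nat \<Rightarrow> real" and \<sigma> :: "nat \<Rightarrow> nat" and n :: nat
  assumes inv: "\<And>i. \<sigma> (\<sigma> i) = i"
    and B: "\<And>i j. \<bar>B i j\<bar> \<le> 1"
  obtains e :: real and d :: "nat \<Rightarrow> real" and X :: "nat \<Rightarrow> nat \<Rightarrow> real"
  where "e > 0"
    and "\<And>i j. X (\<sigma> i) j + e * (\<Sum>k<n. B i k * X k j) + d i * X i j = (if i = j then 1 else 0)"
    and "\<And>i. \<sigma> i \<noteq> i \<Longrightarrow> X i i = 0"
proof -
  \<comment> \<open>The map \<open>F\<close> below has Lipschitz constant at most
    \<open>16 * e * n\<close>, where 16 = 3 + 12 + 1 comes from the three terms of
    \<open>?D\<close>; hence the 32. The summand 1 keeps \<open>e\<close> positive for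
    \<open>n = 0\<close>.\<close>
  define e :: real where "e = 1 / (32 * (real n + 1))"
  have e: "e > 0" and en: "e * real n \<le> 1 / 32"
    by (simp_all add: e_def field_simps)
  define S :: "(nat \<times> nat \<Rightarrow> real) \<Rightarrow> nat \<Rightarrow> nat \<Rightarrow> real"
    where "S X i j = (\<Sum>k<n. B i k * X (k, j))" for X i j
  define Q :: "(nat \<times> nat \<Rightarrow> real) \<Rightarrow> nat \<Rightarrow> nat \<Rightarrow> real"
    where "Q X i j = X (\<sigma> i, j) / X (\<sigma> i, i)" for X i j
  define A :: "nat \<times> nat \<Rightarrow> real" where "A = (\<lambda>(i, j). if j = \<sigma> i then 1 else 0)"
  \<comment> \<open>Multiplication by the permutation matrix moves row \<open>\<sigma> i\<close> to
    row \<open>i\<close>, and the product \<open>S * Q\<close> is the contribution of the eliminated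
    \<open>d (\<sigma> i)\<close>. For \<open>j = i\<close> the quotient \<open>Q\<close> is 1 when
    its denominator is nonzero, so the bracket vanishes.\<close>
  define F where "F X = (\<lambda>(i, j). A (i, j) + e * (S X (\<sigma> i) i * Q X i j - S X (\<sigma> i) j))" for X
  have S_bound: "\<bar>S X i j\<bar> \<le> real n * c" if "\<And>b. \<bar>X b\<bar> \<le> c" for X i j c
  proof -
    have "\<bar>S X i j\<bar> \<le> (\<Sum>k<n. \<bar>B i k * X (k, j)\<bar>)"
      unfolding S_def by (rule sum_abs)
    also have "\<dots> \<le> (\<Sum>k<n. 1 * c)"
      unfolding abs_mult by (intro sum_mono mult_mono B that) simp_all
    finally show ?thesis by simp
  qed
  have S_diff: "\<bar>S X i j - S Y i j\<bar> \<le> real n * c" if "\<And>b. \<bar>X b - Y b\<bar> \<le> c" for X Y i j c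
  proof -
    have "S X i j - S Y i j = S (\<lambda>b. X b - Y b) i j"
      by (simp add: S_def sum_subtractf right_diff_distrib)
    with S_bound[OF that] show ?thesis by simp
  qed
  \<comment> \<open>The radius 1/2 keeps the denominators of \<open>Q\<close>, which equal 1 at
    \<open>A\<close>, at least 1/2, while all entries stay below 3/2 in absolute value or equal to
    it.\<close>
  have upper: "\<bar>X b\<bar> \<le> 3 / 2" if "\<And>b. \<bar>X b - A b\<bar> \<le> 1 / 2" for X b
    using that[of b] unfolding abs_le_iff by (cases b) (auto simp: A_def split: if_splits)
  have lower: "X (\<sigma> i, i) \<ge> 1 / 2" if "\<And>b. \<bar>X b - A b\<bar> \<le> 1 / 2" for X i
    using that[of "(\<sigma> i, i)"] by (auto simp: A_def inv abs_if split: if_splits)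
  have Q_bound: "\<bar>Q X i j\<bar> \<le> 3" if X: "\<And>b. \<bar>X b - A b\<bar> \<le> 1 / 2" for X i j
  proof -
    have "\<bar>X (\<sigma> i, j)\<bar> \<le> 3 * X (\<sigma> i, i)"
      using upper[OF X, of "(\<sigma> i, j)"] lower[OF X, of i] by linarith
    then show ?thesis
      using lower[OF X, of i] by (simp add: Q_def abs_divide divide_le_eq)
  qed
  have Q_diff: "\<bar>Q X i j - Q Y i j\<bar> \<le> 8 * c"
    if X: "\<And>b. \<bar>X b - A b\<bar> \<le> 1 / 2" and Y: "\<And>b. \<bar>Y b - A b\<bar> \<le> 1 / 2"
      and XY: "\<And>b. \<bar>X b - Y b\<bar> \<le> c" for X Y i j c
  proof -
    let ?x = "X (\<sigma> i, i)" and ?y = "Y (\<sigma> i, i)"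
    have x: "?x \<ge> 1 / 2" and y: "?y \<ge> 1 / 2"
      using lower X Y by blast+
    have "Q X i j - Q Y i j = ((X (\<sigma> i, j) - Y (\<sigma> i, j)) + Q Y i j * (?y - ?x)) / ?x"
      using x y by (simp add: Q_def field_simps)
    also have "\<bar>\<dots>\<bar> \<le> (4 * c) / ?x"
    proof -
      have "\<bar>Q Y i j * (?y - ?x)\<bar> \<le> 3 * c"
        unfolding abs_mult using Q_bound[OF Y] XY[of "(\<sigma> i, i)"]
        by (intro mult_mono) (simp_all add: abs_minus_commute)
      with XY[of "(\<sigma> i, j)"] have "\<bar>(X (\<sigma> i, j) - Y (\<sigma> i, j)) + Q Y i j * (?y - ?x)\<bar> \<le> 4 * c"
        by linarith
      then show ?thesis
        using x by (simp add: abs_divide divide_right_mono)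
    qed
    also have "\<dots> \<le> (4 * c) / (1 / 2)"
      using x XY[of "(0, 0)"] by (intro divide_left_mono) auto
    finally show ?thesis by simp
  qed
  have "\<exists>X. (\<forall>a. \<bar>X a - A a\<bar> \<le> 1 / 2) \<and> F X = X"
  proof (rule sup_contraction_fixpoint)
    fix a :: "nat \<times> nat"
    obtain i j where a: "a = (i, j)" by fastforce
    have A: "\<bar>A b - A b\<bar> \<le> 1 / 2" for b by simp
    have "\<bar>S A (\<sigma> i) i * Q A i j\<bar> \<le> (real n * (3 / 2)) * 3"
      unfolding abs_mult by (intro mult_mono S_bound upper Q_bound A) simp_all
    moreover have "\<bar>S A (\<sigma> i) j\<bar> \<le> real n * (3 / 2)"
      by (intro S_bound upper A)
    ultimately have "\<bar>S A (\<sigma> i) i * Q A i j - S A (\<sigma> i) j\<bar> \<le> 6 * real n"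
      by linarith
    then have "e * \<bar>S A (\<sigma> i) i * Q A i j - S A (\<sigma> i) j\<bar> \<le> e * (6 * real n)"
      using e by (intro mult_left_mono) simp_all
    also have "\<dots> \<le> 1 / 2 / 2"
      using en by simp
    finally show "\<bar>F A a - A a\<bar> \<le> 1 / 2 / 2"
      using e by (simp add: F_def a abs_mult)
  next
    fix X Y :: "nat \<times> nat \<Rightarrow> real" and c :: real and a :: "nat \<times> nat"
    assume X: "\<And>b. \<bar>X b - A b\<bar> \<le> 1 / 2" and Y: "\<And>b. \<bar>Y b - A b\<bar> \<le> 1 / 2"
      and XY: "\<And>b. \<bar>X b - Y b\<bar> \<le> c"
    obtain i j where a: "a = (i, j)" by fastforce
    have c: "c \<ge> 0" using XY[of "(0, 0)"] by simp
    have 1: "\<bar>(S X (\<sigma> i) i - S Y (\<sigma> i) i) * Q X i j\<bar> \<le> (real n * c) * 3"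
      unfolding abs_mult using c by (intro mult_mono S_diff Q_bound X XY) simp_all
    have 2: "\<bar>S Y (\<sigma> i) i * (Q X i j - Q Y i j)\<bar> \<le> (real n * (3 / 2)) * (8 * c)"
      unfolding abs_mult using c by (intro mult_mono S_bound upper Q_diff X Y XY) simp_all
    have 3: "\<bar>S X (\<sigma> i) j - S Y (\<sigma> i) j\<bar> \<le> real n * c"
      by (intro S_diff XY)
    let ?D = "(S X (\<sigma> i) i - S Y (\<sigma> i) i) * Q X i j + S Y (\<sigma> i) i * (Q X i j - Q Y i j)
        - (S X (\<sigma> i) j - S Y (\<sigma> i) j)"
    have "\<bar>?D\<bar> \<le> 16 * (real n * c)"
      using 1 2 3 by (simp only: abs_le_iff) (simp add: algebra_simps)
    then have "e * \<bar>?D\<bar> \<le> e * (16 * (real n * c))"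
      using e by (intro mult_left_mono) simp_all
    also have "\<dots> = 16 * c * (e * real n)" by simp
    also have "\<dots> \<le> 16 * c * (1 / 32)"
      using c by (intro mult_left_mono en) simp
    finally have "e * \<bar>?D\<bar> \<le> c / 2" by simp
    moreover have "F X a - F Y a = e * ?D"
      by (simp add: F_def a algebra_simps)
    ultimately show "\<bar>F X a - F Y a\<bar> \<le> c / 2"
      using e by (simp add: abs_mult)
  qed
  then obtain X where X: "\<And>a. \<bar>X a - A a\<bar> \<le> 1 / 2" and FX: "F X = X" by blast
  have pos: "X (\<sigma> i, i) > 0" for i
    using lower[OF X, of i] by linarith
  have fix_eq: "X (i, j) = A (i, j) + e * (S X (\<sigma> i) i * Q X i j - S X (\<sigma> i) j)" for i j
    using fun_cong[OF FX, of "(i, j)"] by (simp add: F_def)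
  show ?thesis
  proof (rule that[of e "\<lambda>i j. X (i, j)" "\<lambda>i. - e * S X i (\<sigma> i) / X (i, \<sigma> i)"])
    show "e > 0" by (rule e)
    \<comment> \<open>This is the fixed point equation in row \<open>\<sigma> i\<close>, because
      \<open>\<sigma> (\<sigma> i) = i\<close>.\<close>
    show "X (\<sigma> i, j) + e * (\<Sum>k<n. B i k * X (k, j)) + - e * S X i (\<sigma> i) / X (i, \<sigma> i) * X (i, j)
        = (if i = j then 1 else 0)" for i j
      unfolding fix_eq[of "\<sigma> i"] by (simp add: inv A_def Q_def S_def[symmetric] algebra_simps)
    show "X (i, i) = 0" if "\<sigma> i \<noteq> i" for i
      using pos[of i] that fix_eq[of i i] by (simp add: A_def Q_def)
  qed
qed

section \<open>P-vertices from zero diagonal entries of the inverse\<close>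

lemma order_eq_1I:
  fixes p :: "'a :: {idom, semiring_char_0} poly"
  assumes "poly p a = 0" and "poly (pderiv p) a \<noteq> 0"
  shows "order a p = 1"
proof -
  have "p \<noteq> 0"
    using assms(2) by auto
  then have "order a p = Suc (order a (pderiv p))"
    using assms(1) by (rule order_pderiv)
  also have "order a (pderiv p) = 0"
    using assms(2) by (rule order_0I)
  finally show ?thesis by simp
qed

text \<open>
  With \<open>\<chi>\<close> the characteristic polynomial of \<open>A\<close>, column \<open>i\<close> of the adjugate of \<open>xI - A\<close> is a
  polynomial vector \<open>q\<close> with \<open>(xI - A) q = \<chi> e\<^sub>i\<close> whose \<open>i\<close>-th entry is the
  characteristic polynomial of \<open>A(i)\<close>. At \<open>x = 0\<close>, the vectors \<open>u = q(0)\<close> and \<open>v = q'(0)\<close> satisfy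
  \<open>A u = -\<chi>(0) e\<^sub>i\<close> and \<open>A v = u - \<chi>'(0) e\<^sub>i\<close>. The first equation gives \<open>u\<^sub>i = 0\<close>, and then
  symmetry gives \<open>u \<bullet> u = u \<bullet> A v = A u \<bullet> v = -\<chi>(0) v\<^sub>i\<close>, so \<open>0\<close> is a simple root of \<open>q\<^sub>i\<close>.
\<close>

lemma P_vertexI:
  fixes A X :: "real mat"
  assumes A: "A \<in> carrier_mat n n" and X: "X \<in> carrier_mat n n"
    and sym: "transpose_mat A = A" and AX: "A * X = 1\<^sub>m n"
    and i: "i < n" and Xii: "X $$ (i, i) = 0"
  shows "P_vertex A i"
proof -
  have XA: "X * A = 1\<^sub>m n"
    by (rule mat_mult_left_right_inverse[OF A X AX])
  have "det A * det X = 1"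
    using det_mult[OF A X] AX by simp
  then have "det A \<noteq> 0" by auto
  have Asym: "A $$ (k, j) = A $$ (j, k)" if "k < n" "j < n" for k j
    using A that by (subst sym[symmetric]) simp
  have XA_sum: "(\<Sum>j<n. X $$ (l, j) * A $$ (j, k)) = (if l = k then 1 else 0)"
    if "l < n" "k < n" for l k
  proof -
    have "(\<Sum>j<n. X $$ (l, j) * A $$ (j, k)) = (X * A) $$ (l, k)"
      using A X that by (simp add: scalar_prod_def atLeast0LessThan)
    then show ?thesis using XA that by simp
  qed
  define \<chi> where "\<chi> = char_poly A"
  define C where "C = char_poly_matrix A"
  define q where "q j = cofactor C i j" for j
  define u where "u j = poly (q j) 0" for j
  define v where "v j = poly (pderiv (q j)) 0" for j
  define c where "c = poly \<chi> 0"
  define c' where "c' = poly (pderiv \<chi>) 0"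
  have C: "C \<in> carrier_mat n n"
    using A by (simp add: C_def)
  have "poly \<chi> 0 = det (- char_matrix A 0)"
    unfolding \<chi>_def by (rule char_poly_matrix[OF A])
  also have "- char_matrix A 0 = -1 \<cdot>\<^sub>m A"
    using A by (intro eq_matI) (auto simp: char_matrix_def)
  finally have c: "c \<noteq> 0"
    using A \<open>det A \<noteq> 0\<close> by (simp add: c_def det_smult)
  have qi: "q i = char_poly (mat_delete A i i)"
  proof -
    have "mat_delete C i i = char_poly_matrix (mat_delete A i i)"
      using A i by (intro eq_matI) (auto simp: C_def mat_delete_def char_poly_matrix_def)
    then show ?thesis
      by (simp add: q_def cofactor_def char_poly_def)
  qed
  \<comment> \<open>Column \<open>i\<close> of \<open>C * adj_mat C = det C * I\<close>, with the
    diagonal part \<open>x\<close> of \<open>C\<close> split off.\<close>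
  have col: "[:0, 1:] * q k - (\<Sum>j<n. Polynomial.smult (A $$ (k, j)) (q j)) = (if k = i then \<chi> else 0)"
    if k: "k < n" for k
  proof -
    have "(C * adj_mat C) $$ (k, i) = (if k = i then \<chi> else 0)"
      using adj_mat(2)[OF C] k i by (simp add: \<chi>_def char_poly_def C_def)
    moreover have "(C * adj_mat C) $$ (k, i) = (\<Sum>j<n. C $$ (k, j) * q j)"
      using C k i by (simp add: scalar_prod_def adj_mat_def q_def atLeast0LessThan)
    moreover have "(\<Sum>j<n. C $$ (k, j) * q j)
        = (\<Sum>j<n. (if k = j then [:0, 1:] * q j else 0) - Polynomial.smult (A $$ (k, j)) (q j))"
      using A k by (intro sum.cong) (auto simp: C_def char_poly_matrix_def algebra_simps)
    ultimately show ?thesis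
      using k by (simp add: sum_subtractf)
  qed
  have Au: "(\<Sum>j<n. A $$ (k, j) * u j) = (if k = i then - c else 0)" if "k < n" for k
    using arg_cong[OF col[OF that], of "\<lambda>p. poly p 0"]
    by (auto simp: u_def c_def poly_sum split: if_splits)
  have Av: "u k - (\<Sum>j<n. A $$ (k, j) * v j) = (if k = i then c' else 0)" if "k < n" for k
    using arg_cong[OF col[OF that], of "\<lambda>p. poly (pderiv p) 0"]
    by (simp add: u_def v_def c'_def poly_sum pderiv_diff pderiv_mult pderiv_sum pderiv_smult
        pderiv_pCons split: if_splits)
  \<comment> \<open>Applying \<open>X\<close> to \<open>A u = - c e_i\<close> turns
    \<open>u i\<close> into \<open>- c * X $$ (i, i)\<close>.\<close>
  have "u i = (\<Sum>k<n. if i = k then u k else 0)"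
    using i by simp
  also have "\<dots> = (\<Sum>k<n. (\<Sum>j<n. X $$ (i, j) * A $$ (j, k)) * u k)"
    using i by (intro sum.cong) (auto simp: XA_sum)
  also have "\<dots> = (\<Sum>j<n. X $$ (i, j) * (\<Sum>k<n. A $$ (j, k) * u k))"
    unfolding sum_distrib_left sum_distrib_right
    by (subst sum.swap) (simp add: mult.assoc)
  also have "\<dots> = (\<Sum>j<n. if j = i then - c * X $$ (i, i) else 0)"
    by (intro sum.cong) (auto simp: Au)
  finally have ui: "u i = 0"
    using Xii i by simp
  \<comment> \<open>The vectors \<open>u\<close> and \<open>A v\<close> differ only in entry
    \<open>i\<close>, where the factor \<open>u i = 0\<close> hides the difference.\<close>
  have "(\<Sum>k<n. u k * u k) = (\<Sum>k<n. u k * (\<Sum>j<n. A $$ (k, j) * v j))"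
  proof (intro sum.cong refl)
    fix k assume "k \<in> {..<n}"
    then show "u k * u k = u k * (\<Sum>j<n. A $$ (k, j) * v j)"
      using Av[of k] ui by (cases "k = i") simp_all
  qed
  also have "\<dots> = (\<Sum>j<n. (\<Sum>k<n. A $$ (j, k) * u k) * v j)"
    unfolding sum_distrib_left sum_distrib_right
    by (subst sum.swap) (auto intro!: sum.cong simp: Asym)
  also have "\<dots> = (\<Sum>j<n. if j = i then - c * v i else 0)"
    by (intro sum.cong) (auto simp: Au)
  finally have uu: "(\<Sum>k<n. u k * u k) = - c * v i"
    using i by simp
  \<comment> \<open>Otherwise the real vector \<open>u\<close> has norm 0, contradicting
    \<open>A u = - c e_i\<close> with \<open>c\<close> nonzero.\<close>
  have "v i \<noteq> 0"
  proof
    assume "v i = 0"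
    with uu have "(\<Sum>k<n. u k * u k) = 0" by simp
    then have "u k = 0" if "k < n" for k
      using that by (subst (asm) sum_nonneg_eq_0_iff) auto
    then show False
      using Au[OF i] c by simp
  qed
  then have "order 0 (q i) = 1"
    using ui by (intro order_eq_1I) (simp_all add: u_def v_def)
  moreover have "order 0 \<chi> = 0"
    using c by (intro order_0I) (simp add: c_def)
  ultimately show ?thesis
    by (simp add: P_vertex_def alg_mult_def qi \<chi>_def)
qed

section \<open>From a perfect matching to the covering matrix\<close>

lemma perfect_matching_involution:
  assumes simple: "simple_graph n E" and matching: "has_perfect_matching n E"
  obtains \<sigma> :: "nat \<Rightarrow> nat"
  where "\<And>i. \<sigma> (\<sigma> i) = i"
    and "\<And>i. i < n \<Longrightarrow> \<sigma> i < n \<and> \<sigma> i \<noteq> i \<and> {i, \<sigma> i} \<in> E"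
proof -
  obtain M where M: "M \<subseteq> E" and unique: "\<And>i. i < n \<Longrightarrow> \<exists>!e. e \<in> M \<and> i \<in> e"
    using matching unfolding has_perfect_matching_def perfect_matching_def by auto
  have "\<exists>j<n. j \<noteq> i \<and> {i, j} \<in> M" if i: "i < n" for i
  proof -
    obtain e where e: "e \<in> M" "i \<in> e"
      using unique[OF i] by blast
    then have "e \<subseteq> {0..<n}" "card e = 2"
      using M simple unfolding simple_graph_def by auto
    then obtain x y where "e = {x, y}" "x \<noteq> y"
      unfolding card_2_iff by blast
    with e \<open>e \<subseteq> {0..<n}\<close> show ?thesis
      by (auto simp: insert_commute)
  qed
  then obtain f where f: "\<And>i. i < n \<Longrightarrow> f i < n \<and> f i \<noteq> i \<and> {i, f i} \<in> M"
    by metis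
  have disjoint: "e = e'" if "i < n" "e \<in> M" "i \<in> e" "e' \<in> M" "i \<in> e'" for i e e'
    using unique[OF that(1)] that(2-5) by blast
  have ff: "f (f i) = i" if "i < n" for i
  proof -
    \<comment> \<open>Both are matching edges through \<open>f i\<close>, so they coincide.\<close>
    have "{f i, f (f i)} = {i, f i}"
      using f[OF that] f[of "f i"] by (intro disjoint[of "f i"]) simp_all
    then show ?thesis
      using f[of "f i"] f[OF that] by (auto simp: doubleton_eq_iff)
  qed
  show ?thesis
  \<comment> \<open>Extending by the identity beyond \<open>n\<close> makes the involution law hold
    on all naturals.\<close>
  proof (rule that[of "\<lambda>i. if i < n then f i else i"])
    fix i
    show "(if (if i < n then f i else i) < n then f (if i < n then f i else i)
        else (if i < n then f i else i)) = i"
      using f[of i] ff[of i] by simp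
    show "(if i < n then f i else i) < n \<and> (if i < n then f i else i) \<noteq> i
        \<and> {i, if i < n then f i else i} \<in> E" if "i < n"
      using f[OF that] M that by auto
  qed
qed

lemma exists_nonsingular_all_P_vertices:
  assumes simple: "simple_graph n E" and matching: "has_perfect_matching n E"
  obtains A where "A \<in> sym_mats n E" and "invertible_mat A" and "\<And>i. i < n \<Longrightarrow> P_vertex A i"
proof -
  obtain \<sigma> where inv: "\<And>i. \<sigma> (\<sigma> i) = i"
    and \<sigma>: "\<And>i. i < n \<Longrightarrow> \<sigma> i < n \<and> \<sigma> i \<noteq> i \<and> {i, \<sigma> i} \<in> E"
    by (rule perfect_matching_involution[OF simple matching]) (rule that)
  define B :: "nat \<Rightarrow> nat \<Rightarrow> real" where "B i j = (if i \<noteq> j \<and> {i, j} \<in> E then 1 else 0)" for i j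
  have B: "\<bar>B i j\<bar> \<le> 1" for i j
    by (simp add: B_def)
  obtain e d X where e: "e > 0"
    and eqn: "\<And>i j. X (\<sigma> i) j + e * (\<Sum>k<n. B i k * X k j) + d i * X i j = (if i = j then 1 else 0)"
    and diag: "\<And>i. \<sigma> i \<noteq> i \<Longrightarrow> X i i = 0"
    by (rule perturbed_involution_inverse[of \<sigma> B n, OF inv B]) (rule that)
  define a where "a i j = (if j = \<sigma> i then 1 else 0) + e * B i j + (if j = i then d i else 0)" for i j
  define A where "A = mat n n (\<lambda>(i, j). a i j)"
  define Y where "Y = mat n n (\<lambda>(i, j). X i j)"
  have A: "A \<in> carrier_mat n n" and Y: "Y \<in> carrier_mat n n"
    by (simp_all add: A_def Y_def)
  have a_sym: "a i j = a j i" for i j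
    using inv by (auto simp: a_def B_def insert_commute)
  have sym: "transpose_mat A = A"
    by (intro eq_matI) (simp_all add: A_def a_sym)
  \<comment> \<open>Off the diagonal nothing cancels: a matching edge has entry
    \<open>1 + e\<close>, any other edge has \<open>e\<close>, and \<open>d\<close> does not
    enter.\<close>
  have a_support: "a i j \<noteq> 0 \<longleftrightarrow> {i, j} \<in> E" if "i < n" "i \<noteq> j" for i j
    using e \<sigma>[OF that(1)] that(2) by (auto simp: a_def B_def)
  have "support_edges A = E"
  proof (intro equalityI subsetI)
    fix x assume "x \<in> support_edges A"
    then show "x \<in> E"
      using a_support by (auto simp: support_edges_def A_def)
  next
    fix x assume "x \<in> E"
    then have "x \<subseteq> {0..<n}" "card x = 2"
      using simple unfolding simple_graph_def by auto
    then obtain i j where ij: "x = {i, j}" "i \<noteq> j" "i < n" "j < n"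
      unfolding card_2_iff by auto
    with \<open>x \<in> E\<close> have "a i j \<noteq> 0"
      using a_support by blast
    with ij show "x \<in> support_edges A"
      unfolding support_edges_def mem_Collect_eq
      by (intro exI[of _ i] exI[of _ j]) (simp add: A_def)
  qed
  with A sym have mem: "A \<in> sym_mats n E"
    by (simp add: sym_mats_def)
  have AY: "A * Y = 1\<^sub>m n"
  proof (rule eq_matI)
    fix i j assume "i < dim_row (1\<^sub>m n :: real mat)" "j < dim_col (1\<^sub>m n :: real mat)"
    then have ij: "i < n" "j < n" by simp_all
    have "(A * Y) $$ (i, j) = (\<Sum>k<n. a i k * X k j)"
      using ij by (simp add: A_def Y_def scalar_prod_def atLeast0LessThan)
    also have "\<dots> = (\<Sum>k<n. (if k = \<sigma> i then X (\<sigma> i) j else 0) + e * (B i k * X k j)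
        + (if k = i then d i * X i j else 0))"
      by (intro sum.cong) (auto simp: a_def algebra_simps)
    also have "\<dots> = (if i = j then 1 else 0)"
      using ij \<sigma>[of i] eqn[of i j] by (simp add: sum.distrib sum_distrib_left)
    finally show "(A * Y) $$ (i, j) = 1\<^sub>m n $$ (i, j)"
      using ij by simp
  qed (use A Y in auto)
  have "Y * A = 1\<^sub>m n"
    by (rule mat_mult_left_right_inverse[OF A Y AY])
  with A Y AY have "invertible_mat A"
    by (auto simp: invertible_mat_def inverts_mat_def)
  moreover have "P_vertex A i" if "i < n" for i
    using diag[of i] \<sigma>[OF that] that by (intro P_vertexI[OF A Y sym AY]) (simp_all add: Y_def)
  ultimately show ?thesis
    using mem that by blast
qed

theorem corollary1:
  fixes n :: nat and E :: "nat set set"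
  assumes "n \<ge> 1"
    and "simple_graph n E"
    and "has_perfect_matching n E"
  shows "P_covering_number n E = 1"
proof -
  obtain A where A: "A \<in> sym_mats n E" "invertible_mat A" "\<And>i. i < n \<Longrightarrow> P_vertex A i"
    using exists_nonsingular_all_P_vertices assms(2,3) by blast
  have "finite {A} \<and> P_cover n E {A}"
    using A by (simp add: P_cover_def)
  then have "P_covering_number n E \<le> enat (card {A})"
    unfolding P_covering_number_def by (intro Inf_lower) blast
  moreover have "1 \<le> P_covering_number n E"
    unfolding P_covering_number_def
  proof (rule Inf_greatest, clarify)
    fix \<A> assume "finite \<A>" and "P_cover n E \<A>"
    moreover from this have "\<A> \<noteq> {}"
      using \<open>n \<ge> 1\<close> by (auto simp: P_cover_def dest: spec[of _ 0])
    \<comment> \<open>Finiteness matters here, since \<open>card\<close> is 0 on infinite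
      sets.\<close>
    ultimately have "card \<A> \<ge> 1"
      by (simp add: Suc_le_eq card_gt_0_iff)
    then show "1 \<le> enat (card \<A>)"
      by (simp add: one_enat_def)
  qed
  ultimately show ?thesis
    by (simp add: one_enat_def)
qed

end
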